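(* Let $a_n$ ($n\in\mathbb{Z}$) and $b_m$ ($m\in\mathbb{Z}$) be non-zero real numbers with $a_n\neq b_m$ for all $n,m$. Let $\tau_n^m=\tau_n^m(x,t;y)$ be a nowhere vanishing complex-valued function of $(m,n)\in\mathbb{Z}^2$ and $(x,t,y)\in\mathbb{R}^3$, smooth in $(x,t,y)$, which satisfies, for all $m,n$, the bilinear equations $$\tfrac12 D_xD_y\,\tau_n^m\cdot\tau_n^m=-(\tau^{*m}_{n})^2,\qquad D_x^2\,\tau_n^m\cdot\tau^{*m}_{n}=0,\qquad (D_x^3+D_t)\,\tau_n^m\cdot\tau^{*m}_{n}=0,$$ $$D_y\,\tau_{n+1}^m\cdot\tau_n^m=-a_n\,\tau^{*m}_{n+1}\tau^{*m}_{n},\qquad D_y\,\tau_{n}^{m+1}\cdot\tau_n^m=-b_m\,\tau^{*\,m+1}_{n}\tau^{*m}_{n},$$ $$b_m\,\tau^{*\,m+1}_{n}\tau_{n+1}^m-a_n\,\tau^{*m}_{n+1}\tau_n^{m+1}+(a_n-b_m)\,\tau^{*\,m+1}_{n+1}\tau_n^m=0 .$$ Define $$\Theta_n^m:=\frac{2}{\sqrt{-1}}\log\frac{\tau_n^m}{\tau^{*m}_{n}},\qquad \gamma_n^m:=\begin{bmatrix}-\frac12\left(\log \tau_n^m\tau^{*m}_{n}\right)_y\\[1mm] \frac{1}{2\sqrt{-1}}\left(\log\frac{\tau_n^m}{\tau^{*m}_{n}}\right)_y\end{bmatrix}.$$ Then $\gamma_n^m$ is expressed in terms of $\Theta_n^m$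 by $$\gamma_n^m(x,t;y)=\begin{bmatrix}\int^x\cos\Theta_n^m(x',t;y)\,dx'\\[1mm] \int^x\sin\Theta_n^m(x',t;y)\,dx'\end{bmatrix}=\begin{bmatrix}\sum_{n'}^{n-1}a_{n'}\cos\left(\frac{\Theta_{n'}^m(x,t;y)+\Theta_{n'+1}^m(x,t;y)}{2}\right)\\[1mm] \sum_{n'}^{n-1}a_{n'}\sin\left(\frac{\Theta_{n'}^m(x,t;y)+\Theta_{n'+1}^m(x,t;y)}{2}\right)\end{bmatrix},$$ where $\int^x$ and $\sum_{n'}^{n-1}$ are an indefinite integral and an indefinite sum; that is, $\partial_x\gamma_n^m={}^t(\cos\Theta_n^m,\sin\Theta_n^m)$ and $\gamma_{n+1}^m-\gamma_n^m=a_n\,{}^t\!\left(\cos\frac{\Theta_n^m+\Theta_{n+1}^m}{2},\,\sin\frac{\Theta_n^m+\Theta_{n+1}^m}{2}\right)$.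
   Context: ${}^*$ denotes complex conjugation, so $\tau^{*m}_n$ is the complex conjugate of $\tau_n^m$. $D_x,D_y,D_t$ are Hirota's bilinear operators: $$D_x^iD_y^jD_t^k\,f\cdot g=\left.(\partial_x-\partial_{x'})^i(\partial_y-\partial_{y'})^j(\partial_t-\partial_{t'})^k f(x,y,t)\,g(x',y',t')\right|_{x'=x,\,y'=y,\,t'=t}.$$ The logarithm in $\Theta_n^m$ is a branch that is smooth in $(x,t,y)$; thus $\Theta_n^m$ is real and $e^{\sqrt{-1}\,\Theta_n^m/2}=\tau_n^m/\tau^{*m}_n$. The indefinite integral is determined up to an additive term independent of $x$, the indefinite sum up to an additive term independent of $n$. *)

theory Defs
  imports "HOL-Analysis.Analysis"
begin

fun C_k :: "nat \<Rightarrow> ('a::real_normed_vector \<Rightarrow> 'b::real_normed_vector) \<Rightarrow> bool" where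
  "C_k 0 f \<longleftrightarrow> continuous_on UNIV f"
| "C_k (Suc k) f \<longleftrightarrow>
     (\<forall>p. f differentiable (at p)) \<and> (\<forall>v. C_k k (\<lambda>p. frechet_derivative f (at p) v))"

definition smooth :: "('a::real_normed_vector \<Rightarrow> 'b::real_normed_vector) \<Rightarrow> bool" where
  "smooth f \<longleftrightarrow> (\<forall>k. C_k k f)"

text \<open>
  Functions on three-dimensional space are curried; the arguments are always in the order
  \<open>x\<close>, \<open>t\<close>, \<open>y\<close>.
\<close>

type_synonym field3 = "real \<Rightarrow> real \<Rightarrow> real \<Rightarrow> complex"

definition smooth3 :: "field3 \<Rightarrow> bool" where
  "smooth3 f \<longleftrightarrow> smooth (\<lambda>(x, t, y). f x t y)"

text \<open>
  The operators \<open>\<partial>_x - \<partial>_x'\<close>, \<open>\<partial>_y - \<partial>_y'\<close>, \<open>\<partial>_t - \<partial>_t'\<close> acting on functions of the doubled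
  variables \<open>(x, t, y)\<close>, \<open>(x', t', y')\<close>.
\<close>

type_synonym bifield3 = "real \<Rightarrow> real \<Rightarrow> real \<Rightarrow> field3"

definition diff_x :: "bifield3 \<Rightarrow> bifield3" where
  "diff_x F = (\<lambda>x t y x' t' y'.
     vector_derivative (\<lambda>s. F s t y x' t' y') (at x)
     - vector_derivative (\<lambda>s. F x t y s t' y') (at x'))"

definition diff_y :: "bifield3 \<Rightarrow> bifield3" where
  "diff_y F = (\<lambda>x t y x' t' y'.
     vector_derivative (\<lambda>s. F x t s x' t' y') (at y)
     - vector_derivative (\<lambda>s. F x t y x' t' s) (at y'))"

definition diff_t :: "bifield3 \<Rightarrow> bifield3" where
  "diff_t F = (\<lambda>x t y x' t' y'.
     vector_derivative (\<lambda>s. F x s y x' t' y') (at t)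
     - vector_derivative (\<lambda>s. F x t y x' s y') (at t'))"

text \<open>\<open>hirota i j k f g\<close> is \<open>D_x^i D_y^j D_t^k f \<cdot> g\<close>.\<close>

definition hirota :: "nat \<Rightarrow> nat \<Rightarrow> nat \<Rightarrow> field3 \<Rightarrow> field3 \<Rightarrow> field3" where
  "hirota i j k f g = (\<lambda>x t y.
     ((diff_x ^^ i) ((diff_y ^^ j) ((diff_t ^^ k)
        (\<lambda>x t y x' t' y'. f x t y * g x' t' y')))) x t y x t y)"

definition conj3 :: "field3 \<Rightarrow> field3" where
  "conj3 f = (\<lambda>x t y. cnj (f x t y))"

definition smooth_log_branch :: "field3 \<Rightarrow> field3 \<Rightarrow> bool" where
  "smooth_log_branch L f \<longleftrightarrow> smooth3 L \<and> (\<forall>x t y. exp (L x t y) = f x t y)"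

text \<open>
  In the next two definitions \<open>L\<close> is meant to be a smooth branch of \<open>log (\<tau> / \<tau>\<^sup>*)\<close>. The other
  logarithm, of the positive real \<open>\<tau> \<tau>\<^sup>*\<close>, is the principal one. Both definitions are
  complex-valued; that the values are real is a consequence of \<open>\<tau> / \<tau>\<^sup>*\<close> having modulus one.
\<close>

definition Theta :: "field3 \<Rightarrow> field3" where
  "Theta L = (\<lambda>x t y. 2 / \<i> * L x t y)"

definition gamma :: "field3 \<Rightarrow> field3 \<Rightarrow> real \<Rightarrow> real \<Rightarrow> real \<Rightarrow> complex ^ 2" where
  "gamma \<tau> L = (\<lambda>x t y. vector
     [- (1 / 2) * vector_derivative (\<lambda>s. Ln (\<tau> x t s * cnj (\<tau> x t s))) (at y),
      1 / (2 * \<i>) * vector_derivative (\<lambda>s. L x t s) (at y)])"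

end

theory Submission
  imports Defs
begin

text \<open>
  Put \<open>w = \<tau>\<^sub>y / \<tau>\<close>. Since \<open>\<tau> / \<tau>\<^sup>*\<close> has modulus one, \<open>\<Theta>\<close> is real,
  \<open>\<tau>\<^sup>* / \<tau> = exp (- \<i>\<Theta> / 2)\<close> and \<open>\<gamma> = (- Re w, Im w)\<close>. Dividing the
  \<open>D_x D_y\<close> equation by \<open>\<tau>\<^sup>2\<close> gives \<open>w\<^sub>x = - exp (- \<i>\<Theta>)\<close>, and dividing the \<open>D_y\<close>
  equation in \<open>n\<close> by the product of \<open>\<tau>\<close> at \<open>n\<close> and \<open>n + 1\<close> expresses the difference of \<open>w\<close> as
  \<open>- a exp (- \<i>(\<Theta> + \<Theta>') / 2)\<close>; the claims are the real and imaginary parts of these two identities.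
\<close>

section \<open>Partial derivatives of smooth functions\<close>

definition partial_x :: "field3 \<Rightarrow> field3" where
  "partial_x f = (\<lambda>x t y. vector_derivative (\<lambda>s. f s t y) (at x))"

definition partial_y :: "field3 \<Rightarrow> field3" where
  "partial_y f = (\<lambda>x t y. vector_derivative (\<lambda>s. f x t s) (at y))"

lemma smooth_imp_differentiable:
  assumes "smooth f"
  shows "f differentiable (at p)"
proof -
  have "C_k (Suc 0) f"
    using assms by (simp only: smooth_def)
  then show ?thesis by simp
qed

lemma smooth_frechet_derivative:
  assumes "smooth f"
  shows "smooth (\<lambda>p. frechet_derivative f (at p) v)"
  unfolding smooth_def
proof
  fix k
  have "C_k (Suc k) f"
    using assms by (simp only: smooth_def)
  then show "C_k k (\<lambda>p. frechet_derivative f (at p) v)" by simp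
qed

text \<open>Meant for coordinate lines \<open>l\<close>: there the chain rule turns the Frechet
  derivative, on which \<open>smooth\<close> is built, into the one-variable derivatives that occur
  in the Hirota operators.\<close>

lemma smooth_has_vector_derivative_line:
  assumes "smooth f" and "(l has_vector_derivative v) (at s)"
  shows "((\<lambda>s. f (l s)) has_vector_derivative frechet_derivative f (at (l s)) v) (at s)"
proof -
  have "(f has_derivative frechet_derivative f (at (l s))) (at (l s))"
    using smooth_imp_differentiable[OF assms(1)] by (simp add: frechet_derivative_works)
  from vector_derivative_diff_chain_within[OF assms(2) has_derivative_at_withinI[OF this]]
  show ?thesis by (simp add: o_def)
qed

lemma smooth3_has_partial_x_frechet:
  assumes "smooth3 f"
  shows "((\<lambda>s. f s t y) has_vector_derivative
    frechet_derivative (\<lambda>(x, t, y). f x t y) (at (x, t, y)) (1, 0, 0)) (at x)"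
proof -
  have "((\<lambda>s. (s, t, y)) has_vector_derivative (1, 0, 0)) (at x)"
    by (auto intro!: derivative_eq_intros simp: has_vector_derivative_def zero_prod_def)
  from smooth_has_vector_derivative_line[OF assms[unfolded smooth3_def] this]
  show ?thesis by simp
qed

lemma smooth3_has_partial_y_frechet:
  assumes "smooth3 f"
  shows "((\<lambda>s. f x t s) has_vector_derivative
    frechet_derivative (\<lambda>(x, t, y). f x t y) (at (x, t, y)) (0, 0, 1)) (at y)"
proof -
  have "((\<lambda>s. (x, t, s)) has_vector_derivative (0, 0, 1)) (at y)"
    by (auto intro!: derivative_eq_intros simp: has_vector_derivative_def zero_prod_def)
  from smooth_has_vector_derivative_line[OF assms[unfolded smooth3_def] this]
  show ?thesis by simp
qed

lemma smooth3_has_partial_x: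
  assumes "smooth3 f"
  shows "((\<lambda>s. f s t y) has_vector_derivative partial_x f x t y) (at x)"
  using smooth3_has_partial_x_frechet[OF assms]
  by (metis partial_x_def vector_derivative_at)

lemma smooth3_has_partial_y:
  assumes "smooth3 f"
  shows "((\<lambda>s. f x t s) has_vector_derivative partial_y f x t y) (at y)"
  using smooth3_has_partial_y_frechet[OF assms]
  by (metis partial_y_def vector_derivative_at)

text \<open>A partial derivative is the Frechet derivative in a fixed direction, and
  \<open>smooth\<close> is closed under that by its recursive definition. This permits the
  x-derivative of \<open>partial_y \<tau>\<close> in D_x D_y.\<close>

lemma smooth3_partial_y:
  assumes "smooth3 f"
  shows "smooth3 (partial_y f)"
proof -
  have "(\<lambda>(x, t, y). partial_y f x t y) =
    (\<lambda>p. frechet_derivative (\<lambda>(x, t, y). f x t y) (at p) (0, 0, 1))"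
    using vector_derivative_at[OF smooth3_has_partial_y_frechet[OF assms]]
    by (auto simp: partial_y_def)
  then show ?thesis
    using smooth_frechet_derivative assms unfolding smooth3_def by metis
qed

section \<open>Hirota derivatives in terms of partial derivatives\<close>

lemma diff_y_product:
  assumes "smooth3 f" "smooth3 g"
  shows "diff_y (\<lambda>x t y x' t' y'. f x t y * g x' t' y') x t y x' t' y' =
    partial_y f x t y * g x' t' y' - f x t y * partial_y g x' t' y'"
  unfolding diff_y_def
  by (intro arg_cong2[of _ _ _ _ minus] vector_derivative_at
      has_vector_derivative_mult_left has_vector_derivative_mult_right
      smooth3_has_partial_y assms)

lemma hirota_y:
  assumes "smooth3 f" "smooth3 g"
  shows "hirota 0 1 0 f g x t y =
    partial_y f x t y * g x t y - f x t y * partial_y g x t y"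
  by (simp add: hirota_def diff_y_product assms)

text \<open>The two copies of the variables stay independent until both differences have acted; on
  the diagonal the four terms then agree in pairs, whence the factor 2. Where f does not vanish, the
  right side is 2 f^2 times the x-derivative of f_y / f.\<close>

lemma hirota_xy_self:
  assumes "smooth3 f"
  shows "hirota 1 1 0 f f x t y =
    2 * (partial_x (partial_y f) x t y * f x t y - partial_y f x t y * partial_x f x t y)"
proof -
  note intros = vector_derivative_at has_vector_derivative_diff has_vector_derivative_mult_left
    has_vector_derivative_mult_right smooth3_has_partial_x smooth3_partial_y assms
  have 1: "vector_derivative (\<lambda>s. partial_y f s t y * f x' t' y' - f s t y * partial_y f x' t' y') (at x)
    = partial_x (partial_y f) x t y * f x' t' y' - partial_x f x t y * partial_y f x' t' y'"
    for x t y x' t' y' by (intro intros)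
  have 2: "vector_derivative (\<lambda>s. partial_y f x t y * f s t' y' - f x t y * partial_y f s t' y') (at x')
    = partial_y f x t y * partial_x f x' t' y' - f x t y * partial_x (partial_y f) x' t' y'"
    for x t y x' t' y' by (intro intros)
  show ?thesis
    by (simp add: hirota_def diff_y_product[OF assms assms] diff_x_def 1 2 right_diff_distrib)
qed

section \<open>Derivatives of quotients and of vectors with two entries\<close>

lemma has_vector_derivative_quotient:
  fixes f g :: "real \<Rightarrow> 'a::real_normed_field"
  assumes "(f has_vector_derivative f') (at x)" "(g has_vector_derivative g') (at x)" "g x \<noteq> 0"
  shows "((\<lambda>s. f s / g s) has_vector_derivative (f' * g x - f x * g') / (g x)\<^sup>2) (at x)"
  using has_derivative_divide'[OF assms[unfolded has_vector_derivative_def]]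
  by (simp add: has_vector_derivative_def power2_eq_square scaleR_conv_of_real
      mult.assoc mult.left_commute[of "f x"] flip: right_diff_distrib times_divide_eq_right)

text \<open>Written through the linear maps \<open>axis 1\<close> and \<open>axis 2\<close>, a
  vector of two functions can be differentiated as a sum.\<close>

lemma vector_2_eq_axis:
  "(vector [u, v] :: 'a::real_normed_vector ^ 2) = axis 1 u + axis 2 v"
  by (simp add: vec_eq_iff forall_2 axis_def)

lemma has_vector_derivative_vector_2:
  fixes f g :: "real \<Rightarrow> 'a::real_normed_vector"
  assumes "(f has_vector_derivative f') (at x)" "(g has_vector_derivative g') (at x)"
  shows "((\<lambda>s. vector [f s, g s] :: 'a ^ 2) has_vector_derivative vector [f', g']) (at x)"
proof -
  have norm: "norm (axis i u :: 'a ^ 2) = norm u" for i u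
    by (simp add: norm_vec_def L2_set_def axis_def if_distrib[of norm]
        if_distrib[of "\<lambda>r. r\<^sup>2"] cong: if_cong)
  \<comment> \<open>\<open>axis i\<close> is an isometry, hence the bound 1.\<close>
  have axis: "bounded_linear (axis i :: 'a \<Rightarrow> 'a ^ 2)" for i
    by (rule bounded_linear_intro[where K=1])
      (auto simp: norm, auto simp: axis_def vec_eq_iff)
  show ?thesis
    unfolding vector_2_eq_axis
    by (intro has_vector_derivative_add bounded_linear.has_vector_derivative[OF axis] assms)
qed

section \<open>A single \<tau> with a smooth branch of its phase logarithm\<close>

context
  fixes \<tau> L :: field3
  assumes smooth: "smooth3 \<tau>"
    and nonzero: "\<And>x t y. \<tau> x t y \<noteq> 0"
    and branch: "smooth_log_branch L (\<lambda>x t y. \<tau> x t y / cnj (\<tau> x t y))"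
begin

lemma exp_log_branch: "exp (L x t y) = \<tau> x t y / cnj (\<tau> x t y)"
  using branch by (simp add: smooth_log_branch_def)

lemma exp_minus_log_branch: "exp (- L x t y) = cnj (\<tau> x t y) / \<tau> x t y"
  by (simp add: exp_minus exp_log_branch)

text \<open>A number and its conjugate have the same norm, and the norm of exp z is exp (Re z). This
  is what makes \<open>Theta\<close> real.\<close>

lemma Re_log_branch: "Re (L x t y) = 0"
proof -
  have "exp (Re (L x t y)) = norm (\<tau> x t y / cnj (\<tau> x t y))"
    by (metis exp_log_branch norm_exp_eq_Re)
  then show ?thesis
    using nonzero by (simp add: norm_divide)
qed

lemma Theta_eq_of_real: "Theta L x t y = of_real (2 * Im (L x t y))"
  using Re_log_branch by (simp add: Theta_def complex_eq_iff Re_divide Im_divide)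

text \<open>The quotient of \<tau> by its conjugate is differentiated twice over: as exp of
  \<open>L\<close> by the chain rule, and by the quotient rule. Comparing the results and cancelling
  the nonzero quotient gives \<open>partial_y L\<close>.\<close>

lemma partial_y_log_branch:
  "partial_y L x t y =
    partial_y \<tau> x t y / \<tau> x t y - cnj (partial_y \<tau> x t y / \<tau> x t y)"
proof -
  let ?d = "partial_y \<tau> x t y"
  have "smooth3 L"
    using branch by (simp add: smooth_log_branch_def)
  from field_vector_diff_chain_at[OF smooth3_has_partial_y[OF this] DERIV_exp]
  have "((\<lambda>s. \<tau> x t s / cnj (\<tau> x t s)) has_vector_derivative
      partial_y L x t y * (\<tau> x t y / cnj (\<tau> x t y))) (at y)"
    by (simp add: o_def exp_log_branch)
  moreover have "((\<lambda>s. \<tau> x t s / cnj (\<tau> x t s)) has_vector_derivative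
      (?d * cnj (\<tau> x t y) - \<tau> x t y * cnj ?d) / (cnj (\<tau> x t y))\<^sup>2) (at y)"
    by (intro has_vector_derivative_quotient smooth3_has_partial_y[OF smooth]
        has_vector_derivative_cnj) (simp add: nonzero)
  ultimately have "partial_y L x t y * (\<tau> x t y / cnj (\<tau> x t y)) =
      (?d * cnj (\<tau> x t y) - \<tau> x t y * cnj ?d) / (cnj (\<tau> x t y))\<^sup>2"
    by (rule vector_derivative_unique_at)
  then show ?thesis
    using nonzero[of x t y] by (simp add: field_simps power2_eq_square)
qed

lemma partial_y_Ln_modulus:
  "vector_derivative (\<lambda>s. Ln (\<tau> x t s * cnj (\<tau> x t s))) (at y) =
    partial_y \<tau> x t y / \<tau> x t y + cnj (partial_y \<tau> x t y / \<tau> x t y)"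
proof -
  let ?d = "partial_y \<tau> x t y"
  have "((\<lambda>s. \<tau> x t s * cnj (\<tau> x t s)) has_vector_derivative
      \<tau> x t y * cnj ?d + ?d * cnj (\<tau> x t y)) (at y)"
    by (intro has_vector_derivative_mult smooth3_has_partial_y[OF smooth]
        has_vector_derivative_cnj)
  \<comment> \<open>The squared modulus is positive, so it avoids the branch cut of
    \<open>Ln\<close>.\<close>
  moreover have "\<tau> x t y * cnj (\<tau> x t y) \<notin> \<real>\<^sub>\<le>\<^sub>0"
    using nonzero[of x t y] by (simp add: complex_mult_cnj complex_nonpos_Reals_iff complex_eq_iff
      sum_power2_le_zero_iff not_le)
  ultimately have "((\<lambda>s. Ln (\<tau> x t s * cnj (\<tau> x t s))) has_vector_derivative
      (\<tau> x t y * cnj ?d + ?d * cnj (\<tau> x t y)) * inverse (\<tau> x t y * cnj (\<tau> x t y))) (at y)"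
    using field_vector_diff_chain_at[OF _ has_field_derivative_Ln] by (fastforce simp: o_def)
  then show ?thesis
    using nonzero[of x t y] by (simp add: vector_derivative_at field_simps)
qed

text \<open>The two logarithmic derivatives are the sum and the difference of w = \<tau>_y / \<tau>
  and its conjugate, that is 2 Re w and 2 i Im w; the prefactors in \<open>gamma\<close> cancel the
  2 and the 2 i.\<close>

lemma gamma_eq:
  "gamma \<tau> L x t y = vector
    [- of_real (Re (partial_y \<tau> x t y / \<tau> x t y)), of_real (Im (partial_y \<tau> x t y / \<tau> x t y))]"
proof -
  let ?w = "partial_y \<tau> x t y / \<tau> x t y"
  have "vector_derivative (\<lambda>s. L x t s) (at y) = ?w - cnj ?w"
    by (metis partial_y_def partial_y_log_branch)
  then show ?thesis
    unfolding gamma_def partial_y_Ln_modulus complex_add_cnj complex_diff_cnj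
    by (simp add: vec_eq_iff forall_2 complex_eq_iff)
qed

text \<open>As \<open>L\<close> is purely imaginary with imaginary part \<open>Theta\<close> / 2,
  this is the phase exp (-i \<open>Theta\<close> / 2) that remains after a bilinear equation is
  divided by values of \<tau>.\<close>

lemma exp_minus_log_branch_eq_cis: "exp (- L x t y) = cis (- Im (L x t y))"
  by (simp add: exp_eq_polar Re_log_branch)

lemma partial_x_log_derivative:
  assumes "1 / 2 * hirota 1 1 0 \<tau> \<tau> x t y = - (cnj (\<tau> x t y))\<^sup>2"
  shows "((\<lambda>s. partial_y \<tau> s t y / \<tau> s t y) has_vector_derivative
    - cis (- 2 * Im (L x t y))) (at x)"
proof -
  have "((\<lambda>s. partial_y \<tau> s t y / \<tau> s t y) has_vector_derivative
      (partial_x (partial_y \<tau>) x t y * \<tau> x t y - partial_y \<tau> x t y * partial_x \<tau> x t y)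
        / (\<tau> x t y)\<^sup>2) (at x)"
    by (intro has_vector_derivative_quotient smooth3_has_partial_x smooth3_partial_y smooth nonzero)
  \<comment> \<open>The numerator of the quotient rule is half of the Hirota derivative.\<close>
  also have "partial_x (partial_y \<tau>) x t y * \<tau> x t y - partial_y \<tau> x t y * partial_x \<tau> x t y
      = - (cnj (\<tau> x t y))\<^sup>2"
    using assms unfolding hirota_xy_self[OF smooth]
    by (simp del: right_diff_distrib_numeral)
  also have "- (cnj (\<tau> x t y))\<^sup>2 / (\<tau> x t y)\<^sup>2 = - (exp (- L x t y))\<^sup>2"
    by (simp add: exp_minus_log_branch power_divide)
  also have "(exp (- L x t y))\<^sup>2 = cis (- 2 * Im (L x t y))"
    by (simp add: exp_minus_log_branch_eq_cis Complex.DeMoivre)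
  finally show ?thesis .
qed

lemma gamma_has_vector_derivative:
  assumes "1 / 2 * hirota 1 1 0 \<tau> \<tau> x t y = - (cnj (\<tau> x t y))\<^sup>2"
  shows "((\<lambda>s. gamma \<tau> L s t y) has_vector_derivative
    vector [cos (Theta L x t y), sin (Theta L x t y)]) (at x)"
proof -
  let ?w = "\<lambda>s. partial_y \<tau> s t y / \<tau> s t y"
  note w = partial_x_log_derivative[OF assms]
  \<comment> \<open>The values -Re and Im of -cis (-\<theta>) are cos \<theta> and sin \<theta>, by
    parity; here \<theta> is twice the imaginary part of \<open>L\<close>.\<close>
  have "((\<lambda>s. - of_real (Re (?w s)) :: complex) has_vector_derivative
      - of_real (Re (- cis (- 2 * Im (L x t y))))) (at x)"
    by (intro has_vector_derivative_minus has_vector_derivative_of_real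
        has_real_derivative_iff_has_vector_derivative[THEN iffD2]
        bounded_linear.has_vector_derivative[OF bounded_linear_Re] w)
  moreover have "((\<lambda>s. of_real (Im (?w s)) :: complex) has_vector_derivative
      of_real (Im (- cis (- 2 * Im (L x t y))))) (at x)"
    by (intro has_vector_derivative_of_real
        has_real_derivative_iff_has_vector_derivative[THEN iffD2]
        bounded_linear.has_vector_derivative[OF bounded_linear_Im] w)
  ultimately show ?thesis
    \<comment> \<open>The complex cosine and sine of the real number \<open>Theta\<close> become
      real ones.\<close>
    unfolding gamma_eq Theta_eq_of_real cos_of_real sin_of_real
    by (auto dest: has_vector_derivative_vector_2)
qed

end

section \<open>Neighbouring sites in n, and the conclusion\<close>

lemma gamma_step:
  assumes "smooth3 \<tau>" "\<And>x t y. \<tau> x t y \<noteq> 0"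
    and "smooth_log_branch L (\<lambda>x t y. \<tau> x t y / cnj (\<tau> x t y))"
    and "smooth3 \<tau>'" "\<And>x t y. \<tau>' x t y \<noteq> 0"
    and "smooth_log_branch L' (\<lambda>x t y. \<tau>' x t y / cnj (\<tau>' x t y))"
    and bilinear: "hirota 0 1 0 \<tau>' \<tau> x t y =
      - complex_of_real c * cnj (\<tau>' x t y) * cnj (\<tau> x t y)"
  shows "gamma \<tau>' L' x t y - gamma \<tau> L x t y = c *\<^sub>R vector
    [cos ((Theta L x t y + Theta L' x t y) / 2), sin ((Theta L x t y + Theta L' x t y) / 2)]"
proof -
  let ?w = "partial_y \<tau> x t y / \<tau> x t y" and ?w' = "partial_y \<tau>' x t y / \<tau>' x t y"
  let ?\<theta> = "Im (L x t y) + Im (L' x t y)"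
  \<comment> \<open>D_y of a pair, divided by their product, is the difference of their logarithmic
    derivatives.\<close>
  have "?w' - ?w = hirota 0 1 0 \<tau>' \<tau> x t y / (\<tau>' x t y * \<tau> x t y)"
    using assms(2,5)[of x t y] unfolding hirota_y[OF assms(4,1)] by (simp add: field_simps)
  also have "\<dots> = - of_real c * (exp (- L x t y) * exp (- L' x t y))"
    unfolding bilinear
    by (simp add: exp_minus_log_branch[OF assms(1-3)] exp_minus_log_branch[OF assms(4-6)] mult_ac)
  also have "exp (- L x t y) * exp (- L' x t y) = cis (- ?\<theta>)"
    by (simp add: exp_minus_log_branch_eq_cis[OF assms(1-3)]
        exp_minus_log_branch_eq_cis[OF assms(4-6)] cis_mult)
  finally have w: "?w' - ?w = - of_real c * cis (- ?\<theta>)" .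
  \<comment> \<open>The minus sign stays outside the sum \<open>?\<theta>\<close>, so that the
    parity of cosine and sine applies.\<close>
  have re: "Re ?w' - Re ?w = - c * cos ?\<theta>" and im: "Im ?w' - Im ?w = c * sin ?\<theta>"
    using arg_cong[OF w, of Re] arg_cong[OF w, of Im]
    by (simp_all del: minus_add_distrib)
  have th: "(Theta L x t y + Theta L' x t y) / 2 = of_real ?\<theta>"
    by (simp add: Theta_eq_of_real[OF assms(1-3)] Theta_eq_of_real[OF assms(4-6)])
  have "- of_real (Re ?w') + of_real (Re ?w) = c *\<^sub>R (of_real (cos ?\<theta>) :: complex)"
    using arg_cong[OF re, of "\<lambda>r. - complex_of_real r"] by (simp add: scaleR_conv_of_real)
  moreover have "of_real (Im ?w') - of_real (Im ?w) = c *\<^sub>R (of_real (sin ?\<theta>) :: complex)"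
    using arg_cong[OF im, of complex_of_real] by (simp add: scaleR_conv_of_real)
  ultimately show ?thesis
    unfolding th cos_of_real sin_of_real gamma_eq[OF assms(1-3)] gamma_eq[OF assms(4-6)]
    by (simp add: vec_eq_iff forall_2)
qed

theorem corollary3p2:
  fixes a b :: "int \<Rightarrow> real"
    and \<tau> :: "int \<Rightarrow> int \<Rightarrow> real \<Rightarrow> real \<Rightarrow> real \<Rightarrow> complex"
    and L :: "int \<Rightarrow> int \<Rightarrow> real \<Rightarrow> real \<Rightarrow> real \<Rightarrow> complex"
  assumes a_nonzero: "\<And>n. a n \<noteq> 0"
    and b_nonzero: "\<And>m. b m \<noteq> 0"
    and a_neq_b: "\<And>n m. a n \<noteq> b m"
    and tau_nonzero: "\<And>m n x t y. \<tau> m n x t y \<noteq> 0"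
    and tau_smooth: "\<And>m n. smooth3 (\<tau> m n)"
    and bilinear_xy: "\<And>m n x t y.
      1 / 2 * hirota 1 1 0 (\<tau> m n) (\<tau> m n) x t y = - (cnj (\<tau> m n x t y))\<^sup>2"
    and bilinear_xx: "\<And>m n x t y. hirota 2 0 0 (\<tau> m n) (conj3 (\<tau> m n)) x t y = 0"
    and bilinear_xxx_t: "\<And>m n x t y.
      hirota 3 0 0 (\<tau> m n) (conj3 (\<tau> m n)) x t y
      + hirota 0 0 1 (\<tau> m n) (conj3 (\<tau> m n)) x t y = 0"
    and bilinear_y_n: "\<And>m n x t y.
      hirota 0 1 0 (\<tau> m (n + 1)) (\<tau> m n) x t y
      = - complex_of_real (a n) * cnj (\<tau> m (n + 1) x t y) * cnj (\<tau> m n x t y)"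
    and bilinear_y_m: "\<And>m n x t y.
      hirota 0 1 0 (\<tau> (m + 1) n) (\<tau> m n) x t y
      = - complex_of_real (b m) * cnj (\<tau> (m + 1) n x t y) * cnj (\<tau> m n x t y)"
    and bilinear_mn: "\<And>m n x t y.
      complex_of_real (b m) * cnj (\<tau> (m + 1) n x t y) * \<tau> m (n + 1) x t y
      - complex_of_real (a n) * cnj (\<tau> m (n + 1) x t y) * \<tau> (m + 1) n x t y
      + complex_of_real (a n - b m) * cnj (\<tau> (m + 1) (n + 1) x t y) * \<tau> m n x t y = 0"
    and log_branch: "\<And>m n.
      smooth_log_branch (L m n) (\<lambda>x t y. \<tau> m n x t y / cnj (\<tau> m n x t y))"
  shows "(\<forall>m n x t y. Theta (L m n) x t y \<in> \<real>)
    \<and> (\<forall>m n x t y i. gamma (\<tau> m n) (L m n) x t y $ i \<in> \<real>)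
    \<and> (\<forall>m n x t y.
        ((\<lambda>s. gamma (\<tau> m n) (L m n) s t y) has_vector_derivative
          vector [cos (Theta (L m n) x t y), sin (Theta (L m n) x t y)]) (at x))
    \<and> (\<forall>m n x t y.
        gamma (\<tau> m (n + 1)) (L m (n + 1)) x t y - gamma (\<tau> m n) (L m n) x t y
        = a n *\<^sub>R vector
            [cos ((Theta (L m n) x t y + Theta (L m (n + 1)) x t y) / 2),
             sin ((Theta (L m n) x t y + Theta (L m (n + 1)) x t y) / 2)])"
proof (intro conjI allI)
  note tau = tau_smooth tau_nonzero log_branch
  fix m n :: int and x t y :: real
  show "Theta (L m n) x t y \<in> \<real>"
    by (simp add: Theta_eq_of_real[OF tau])
  show "gamma (\<tau> m n) (L m n) x t y $ i \<in> \<real>" for i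
    using exhaust_2[of i] by (auto simp: gamma_eq[OF tau])
  show "((\<lambda>s. gamma (\<tau> m n) (L m n) s t y) has_vector_derivative
      vector [cos (Theta (L m n) x t y), sin (Theta (L m n) x t y)]) (at x)"
    by (rule gamma_has_vector_derivative[OF tau bilinear_xy])
  show "gamma (\<tau> m (n + 1)) (L m (n + 1)) x t y - gamma (\<tau> m n) (L m n) x t y
      = a n *\<^sub>R vector
          [cos ((Theta (L m n) x t y + Theta (L m (n + 1)) x t y) / 2),
           sin ((Theta (L m n) x t y + Theta (L m (n + 1)) x t y) / 2)]"
    \<comment> \<open>The first \<open>tau\<close> supplies the facts at n, the second those at n +
      1.\<close>
    by (rule gamma_step[OF tau tau bilinear_y_n])
qed

end
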